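(* Let $n>2$ be an integer. Let $G_2$ be the induced subgraph of the comaximal graph $\Gamma(\mathbb{Z}_n)$ on the set of nonzero non-units of $\mathbb{Z}_n$, i.e. on $\{a\in\mathbb{Z}_n: a\neq 0,\ \gcd(a,n)\neq 1\}$. Then the Laplacian characteristic polynomial of $\Gamma(\mathbb{Z}_n)$ is $$\mu(\Gamma(\mathbb{Z}_n),x)=x\,(x-n)^{\phi(n)}\,\mu(G_2,x-\phi(n)),$$ where $\phi$ is Euler's totient function.
   Context: The comaximal graph $\Gamma(\mathbb{Z}_n)$ has vertex set $\mathbb{Z}_n=\{0,1,\dots,n-1\}$, distinct $x,y$ adjacent iff $\langle x\rangle+\langle y\rangle=\mathbb{Z}_n$. For a graph $G$, $L(G)=D(G)-A(G)$ is its Laplacian matrix ($D(G)$ the diagonal degree matrix, $A(G)$ the adjacency matrix), and $\mu(G,x)=\det(xI-L(G))$ is its (Laplacian) characteristic polynomial. If $G_2$ has no vertices (which happens when $n$ is prime), $\mu(G_2,x)$ is taken to be $1$. *)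

theory Defs
  imports
    "HOL-Number_Theory.Residues"
    "HOL-Number_Theory.Totient"
    "Graph_Theory.Graph_Theory"
    "Jordan_Normal_Form.Char_Poly"
begin

(* As usual for Graph_Theory, an undirected graph is a symmetric digraph:
   an edge {x, y} is the pair of arcs (x, y), (y, x). *)
definition comaximal_graph :: "('a, 'b) ring_scheme \<Rightarrow> ('a, 'a \<times> 'a) pre_digraph" where
  "comaximal_graph R =
    \<lparr> verts = carrier R,
      arcs = {(x, y). x \<in> carrier R \<and> y \<in> carrier R \<and> x \<noteq> y \<and>
                      Idl\<^bsub>R\<^esub> {x} <+>\<^bsub>R\<^esub> Idl\<^bsub>R\<^esub> {y} = carrier R},
      tail = fst,
      head = snd \<rparr>"

(* The matrices of a finite graph are indexed by its vertices in increasing order.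
   In a symmetric digraph the degree of a vertex is its out-degree. *)
definition vertex_list :: "('a :: linorder, 'b) pre_digraph \<Rightarrow> 'a list" where
  "vertex_list G = sorted_list_of_set (verts G)"

definition degree_mat :: "('a :: linorder, 'b) pre_digraph \<Rightarrow> real mat" where
  "degree_mat G = mat (card (verts G)) (card (verts G))
    (\<lambda>(i, j). if i = j then real (out_degree G (vertex_list G ! i)) else 0)"

definition adjacency_mat :: "('a :: linorder, 'b) pre_digraph \<Rightarrow> real mat" where
  "adjacency_mat G = mat (card (verts G)) (card (verts G))
    (\<lambda>(i, j). if vertex_list G ! i \<rightarrow>\<^bsub>G\<^esub> vertex_list G ! j then 1 else 0)"

definition laplacian_mat :: "('a :: linorder, 'b) pre_digraph \<Rightarrow> real mat" where
  "laplacian_mat G = degree_mat G - adjacency_mat G"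

definition laplacian_char_poly :: "('a :: linorder, 'b) pre_digraph \<Rightarrow> real poly" where
  "laplacian_char_poly G = char_poly (laplacian_mat G)"

(* The convention for graphs without vertices holds automatically. *)
lemma laplacian_char_poly_null:
  assumes "verts G = {}"
  shows "laplacian_char_poly G = 1"
proof -
  have "laplacian_mat G \<in> carrier_mat 0 0"
    unfolding laplacian_mat_def degree_mat_def adjacency_mat_def carrier_mat_def
    using assms by simp
  then have "char_poly_matrix (laplacian_mat G) \<in> carrier_mat 0 0"
    by (rule char_poly_matrix_closed)
  then show ?thesis
    by (simp add: laplacian_char_poly_def char_poly_def det_dim_zero)
qed

lemma graph_comaximal_graph_residue_ring:
  assumes "n > 1"
  shows "graph (comaximal_graph (residue_ring n))"
proof -
  interpret residues n "residue_ring n"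
    using assms by unfold_locales simp_all
  let ?R = "residue_ring n"
  have fin: "finite (carrier ?R)" by (simp add: res_carrier_eq)
  have comm: "A <+>\<^bsub>?R\<^esub> B = B <+>\<^bsub>?R\<^esub> A" for A B
    by (force simp: set_add_def' residue_ring_def add.commute)
  have "finite {(x, y). x \<in> carrier ?R \<and> y \<in> carrier ?R \<and> x \<noteq> y \<and>
                  Idl\<^bsub>?R\<^esub> {x} <+>\<^bsub>?R\<^esub> Idl\<^bsub>?R\<^esub> {y} = carrier ?R}"
    by (rule finite_subset[OF _ finite_cartesian_product[OF fin fin]]) auto
  then show ?thesis
    using fin comm
    by unfold_locales
       (auto simp: comaximal_graph_def arc_to_ends_def symmetric_conv)
qed

lemma nonzero_nonunits_residue_ring:
  assumes "n > 1"
  shows "{a \<in> carrier (residue_ring n). a \<noteq> 0 \<and> gcd a n \<noteq> 1} =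
         carrier (residue_ring n) - Units (residue_ring n) - {\<zero>\<^bsub>residue_ring n\<^esub>}"
proof -
  interpret residues n "residue_ring n"
    using assms by unfold_locales simp_all
  show ?thesis
    by (auto simp: res_carrier_eq res_units_eq res_zero_eq coprime_iff_gcd_eq_1)
qed

end

theory Submission
  imports Defs
begin

text \<open>
  The units of \<open>\<int>\<^sub>n\<close> are adjacent to all vertices and are the only neighbours of \<open>0\<close>.
  The rows of \<open>M = xI - L\<close> sum to \<open>x\<close>, so adding all columns to the column of \<open>0\<close> extracts
  a factor \<open>x\<close> and leaves a column of ones there. Subtracting this column of ones from the column
  of a unit \<open>u\<close> leaves \<open>x - n\<close> at position \<open>u\<close> and zeros elsewhere. The result is block triangular;
  its remaining block is \<open>xI - L(G\<^sub>2) - \<phi>(n)I\<close>, because each nonzero non-unit has degree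
  \<open>\<phi>(n)\<close> more in the whole graph than in \<open>G\<^sub>2\<close>.
\<close>

section \<open>Determinants and enumerations of the vertices\<close>

text \<open>The two enumerations differ by a permutation that acts on rows and columns alike, so its
  sign occurs twice and cancels.\<close>

lemma det_mat_reindex:
  fixes f :: "'a \<Rightarrow> 'a \<Rightarrow> 'b :: comm_ring_1"
  assumes "distinct xs" "distinct ys" "set xs = set ys"
  shows "det (mat (length xs) (length xs) (\<lambda>(i, j). f (xs ! i) (xs ! j))) =
         det (mat (length ys) (length ys) (\<lambda>(i, j). f (ys ! i) (ys ! j)))"
    (is "det ?A = det ?B")
proof -
  let ?n = "length ys"
  have "mset xs = mset ys"
    using assms by (simp add: set_eq_iff_mset_eq_distinct)
  then obtain p where p: "p permutes {..<?n}" "permute_list p ys = xs"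
    by (rule mset_eq_permutation)
  have len: "length xs = ?n"
    using p(2) by auto
  have p': "p permutes {0..<?n}"
    using p(1) by (simp add: lessThan_atLeast0)
  have nth: "xs ! i = ys ! p i" if "i < ?n" for i
    using permute_list_nth[OF p(1) that] p(2) by simp
  have less: "p i < ?n" if "i < ?n" for i
    using permutes_in_image[OF p(1), of i] that by simp
  \<comment> \<open>\<open>C\<close> is \<open>?B\<close> with only its rows permuted; the columns
    are then treated as rows of the transpose.\<close>
  define C where "C = mat ?n ?n (\<lambda>(i, j). ?B $$ (p i, j))"
  have "?A = (mat ?n ?n (\<lambda>(i, j). C\<^sup>T $$ (p i, j)))\<^sup>T"
    by (rule eq_matI) (auto simp: C_def len nth less)
  then have "det ?A = det (mat ?n ?n (\<lambda>(i, j). C\<^sup>T $$ (p i, j)))"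
    by (simp add: det_transpose[of _ ?n])
  also have "\<dots> = signof p * det (C\<^sup>T)"
    by (rule det_permute_rows[OF _ p']) (simp add: C_def)
  also have "det (C\<^sup>T) = det C"
    by (rule det_transpose[of _ ?n]) (simp add: C_def)
  also have "det C = signof p * det ?B"
    unfolding C_def by (rule det_permute_rows[OF _ p']) simp
  finally show ?thesis
    by (simp add: sign_def split: if_splits)
qed

text \<open>The entries of \<open>xI - L(G)\<close>, indexed by vertices rather than by their positions, so that
  the vertices can be enumerated in any order.\<close>

definition laplacian_char_entry :: "('a, 'b) pre_digraph \<Rightarrow> 'a \<Rightarrow> 'a \<Rightarrow> real poly" where
  "laplacian_char_entry G u v =
    (if u = v then [:- real (out_degree G u), 1:] else if u \<rightarrow>\<^bsub>G\<^esub> v then 1 else 0)"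

lemma (in loopfree_digraph) not_dominates_self: "\<not> u \<rightarrow>\<^bsub>G\<^esub> u"
  using adj_not_same by blast

text \<open>This replaces the sorted order of \<open>vertex_list\<close> by any convenient one.
  Since there are no loops, the adjacency matrix contributes nothing to the diagonal.\<close>

lemma laplacian_char_poly_eq_det:
  assumes "digraph G" "distinct xs" "set xs = verts G"
  shows "laplacian_char_poly G =
    det (mat (length xs) (length xs) (\<lambda>(i, j). laplacian_char_entry G (xs ! i) (xs ! j)))"
proof -
  interpret digraph G by fact
  let ?ys = "vertex_list G"
  have ys: "distinct ?ys" "set ?ys = verts G" "card (verts G) = length ?ys"
    by (simp_all add: vertex_list_def)
  have "char_poly_matrix (laplacian_mat G) =
      mat (length ?ys) (length ?ys) (\<lambda>(i, j). laplacian_char_entry G (?ys ! i) (?ys ! j))"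
    by (rule eq_matI)
      (auto simp: char_poly_matrix_def laplacian_mat_def degree_mat_def adjacency_mat_def
        laplacian_char_entry_def ys not_dominates_self nth_eq_iff_index_eq[OF ys(1)] one_pCons)
  then show ?thesis
    using det_mat_reindex[OF assms(2) ys(1), of "laplacian_char_entry G"] assms(3) ys(2)
    by (simp add: laplacian_char_poly_def char_poly_def)
qed

section \<open>Degrees, row sums and induced subgraphs\<close>

lemma (in nomulti_digraph) out_degree_eq_card: "out_degree G u = card {v. u \<rightarrow>\<^bsub>G\<^esub> v}"
proof -
  have "card (head G ` out_arcs G u) = card (out_arcs G u)"
    by (rule card_image) (auto simp: inj_on_def arc_to_ends_def intro: no_multi_arcs)
  moreover have "head G ` out_arcs G u = {v. u \<rightarrow>\<^bsub>G\<^esub> v}"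
    by (auto simp: arcs_ends_conv image_iff)
  ultimately show ?thesis
    by (simp add: out_degree_def)
qed

text \<open>The ones off the diagonal count the neighbours of \<open>u\<close> and cancel the degree
  subtracted on the diagonal.\<close>

lemma (in digraph) sum_laplacian_char_entry:
  assumes "u \<in> verts G"
  shows "(\<Sum>v\<in>verts G. laplacian_char_entry G u v) = [:0, 1:]"
proof -
  have sub: "{v. u \<rightarrow>\<^bsub>G\<^esub> v} \<subseteq> verts G - {u}"
    by (auto simp: not_dominates_self)
  have "(\<Sum>v\<in>verts G. laplacian_char_entry G u v) =
      [:- real (out_degree G u), 1:] + (\<Sum>v\<in>verts G - {u}. if u \<rightarrow>\<^bsub>G\<^esub> v then 1 else 0)"
    using assms by (subst sum.remove[of _ u]) (auto simp: laplacian_char_entry_def intro!: sum.cong)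
  also have "(\<Sum>v\<in>verts G - {u}. if u \<rightarrow>\<^bsub>G\<^esub> v then 1 else 0 :: real poly) =
      of_nat (out_degree G u)"
    using sub by (subst sum.inter_filter[symmetric])
      (auto simp: out_degree_eq_card not_dominates_self intro!: arg_cong[of _ _ card])
  finally show ?thesis
    by (simp add: of_nat_poly)
qed

text \<open>Each vertex of \<open>ws\<close> loses exactly \<open>k\<close> neighbours in the
  induced subgraph. Replacing x by x - k makes up for this on the diagonal and leaves the constant
  entries off the diagonal unchanged.\<close>

lemma laplacian_char_poly_induce_pcompose:
  assumes "digraph G" "distinct ws" "set ws \<subseteq> verts G"
    and "\<And>w. w \<in> set ws \<Longrightarrow> card {v. w \<rightarrow>\<^bsub>G\<^esub> v \<and> v \<notin> set ws} = k"
  shows "pcompose (laplacian_char_poly (G \<restriction> set ws)) [:- real k, 1:] =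
    det (mat (length ws) (length ws) (\<lambda>(i, j). laplacian_char_entry G (ws ! i) (ws ! j)))"
proof -
  interpret digraph G by fact
  let ?H = "G \<restriction> set ws" and ?q = "[:- real k, 1:]"
  interpret H: digraph ?H
    using assms(3) by (intro digraphI_induced induced_induce)
  have adj: "u \<rightarrow>\<^bsub>?H\<^esub> v \<longleftrightarrow> u \<in> set ws \<and> v \<in> set ws \<and> u \<rightarrow>\<^bsub>G\<^esub> v" for u v
    by (auto simp: arcs_ends_conv)
  have fin: "finite {v. u \<rightarrow>\<^bsub>G\<^esub> v}" for u
    by (rule finite_subset[OF _ finite_verts]) auto
  have deg: "out_degree G w = out_degree ?H w + k" if "w \<in> set ws" for w
  proof -
    have "{v. w \<rightarrow>\<^bsub>G\<^esub> v} = {v. w \<rightarrow>\<^bsub>?H\<^esub> v} \<union> {v. w \<rightarrow>\<^bsub>G\<^esub> v \<and> v \<notin> set ws}"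
      using that by (auto simp: adj)
    moreover have "finite {v. w \<rightarrow>\<^bsub>?H\<^esub> v}" "finite {v. w \<rightarrow>\<^bsub>G\<^esub> v \<and> v \<notin> set ws}"
      using fin[of w] by (auto simp: adj intro: rev_finite_subset)
    moreover have "{v. w \<rightarrow>\<^bsub>?H\<^esub> v} \<inter> {v. w \<rightarrow>\<^bsub>G\<^esub> v \<and> v \<notin> set ws} = {}"
      by (auto simp: adj)
    ultimately show ?thesis
      using assms(4)[OF that]
      by (simp only: out_degree_eq_card H.out_degree_eq_card card_Un_disjoint)
  qed
  have entry: "pcompose (laplacian_char_entry ?H u v) ?q = laplacian_char_entry G u v"
    if "u \<in> set ws" "v \<in> set ws" for u v
    using that by (auto simp: laplacian_char_entry_def adj deg pcompose_pCons pcompose_1)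
  \<comment> \<open>Composition with \<open>?q\<close> is a ring homomorphism, so it commutes with
    the determinant.\<close>
  have "pcompose (laplacian_char_poly ?H) ?q =
      det (map_mat (\<lambda>p. pcompose p ?q)
        (mat (length ws) (length ws) (\<lambda>(i, j). laplacian_char_entry ?H (ws ! i) (ws ! j))))"
    using laplacian_char_poly_eq_det[OF H.digraph_axioms assms(2)]
    by (simp add: comm_ring_hom.hom_det[OF pcompose_hom.comm_ring_hom_axioms])
  also have "map_mat (\<lambda>p. pcompose p ?q)
        (mat (length ws) (length ws) (\<lambda>(i, j). laplacian_char_entry ?H (ws ! i) (ws ! j))) =
      mat (length ws) (length ws) (\<lambda>(i, j). laplacian_char_entry G (ws ! i) (ws ! j))"
    by (rule eq_matI) (auto simp: entry)
  finally show ?thesis .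
qed

section \<open>Graphs with a vertex whose neighbours are adjacent to all vertices\<close>

text \<open>The purely graph-theoretic core: for the comaximal graph, \<open>z\<close> is 0 and
  \<open>U\<close> is the set of units.\<close>

lemma laplacian_char_poly_dominating_neighbours:
  assumes "graph G" "z \<in> verts G"
    and dom: "\<And>u v. z \<rightarrow>\<^bsub>G\<^esub> u \<Longrightarrow> v \<in> verts G \<Longrightarrow> v \<noteq> u \<Longrightarrow> u \<rightarrow>\<^bsub>G\<^esub> v"
  defines "U \<equiv> {u. z \<rightarrow>\<^bsub>G\<^esub> u}"
  shows "laplacian_char_poly G =
    [:0, 1:] * [:- real (card (verts G)), 1:] ^ card U *
      pcompose (laplacian_char_poly (G \<restriction> (verts G - insert z U))) [:- real (card U), 1:]"
proof -
  interpret graph G by fact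
  let ?e = "laplacian_char_entry G"
  define W where "W = verts G - insert z U"
  have zU: "z \<notin> U"
    by (simp add: U_def not_dominates_self)
  have UV: "U \<subseteq> verts G"
    by (auto simp: U_def)
  then have finU: "finite U"
    by (rule finite_subset) simp
  have finW: "finite W"
    by (simp add: W_def)
  obtain us where us: "set us = U" "distinct us"
    using finite_distinct_list[OF finU] by blast
  obtain ws where ws: "set ws = W" "distinct ws"
    using finite_distinct_list[OF finW] by blast
  define k m where "k = length us" and "m = length ws"
  \<comment> \<open>Positions below \<open>k\<close> hold \<open>U\<close>, the next
    \<open>m\<close> hold \<open>W\<close>, and the last one, \<open>k + m\<close>, holds
    \<open>z\<close>. This order makes the reduced matrix block triangular.\<close>
  define xs where "xs = us @ ws @ [z]"
  define N where "N = Suc (k + m)"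
  have xs: "distinct xs" "set xs = verts G" "length xs = N"
    using us ws zU UV assms(2) by (auto simp: xs_def W_def N_def k_def m_def)
  have cardU: "card U = k"
    using us distinct_card by (fastforce simp: k_def)
  have cardV: "card (verts G) = N"
    using xs distinct_card by metis
  have x_U: "xs ! i \<in> U" if "i < k" for i
    using that us by (auto simp: xs_def k_def nth_append)
  have x_W: "xs ! (k + i) = ws ! i" if "i < m" for i
    using that by (simp add: xs_def k_def m_def nth_append)
  have x_z: "xs ! (k + m) = z"
    by (simp add: xs_def k_def m_def nth_append)
  have x_V: "xs ! i \<in> verts G" if "i < N" for i
    using that xs by (metis nth_mem)
  have x_eq: "xs ! i = xs ! j \<longleftrightarrow> i = j" if "i < N" "j < N" for i j
    using that xs by (simp add: nth_eq_iff_index_eq)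
  have dom_U: "u \<rightarrow>\<^bsub>G\<^esub> v" "v \<rightarrow>\<^bsub>G\<^esub> u" if "u \<in> U" "v \<in> verts G" "v \<noteq> u" for u v
    using dom[of u v] that arcs_ends_symmetric[OF sym_arcs, of u v] by (auto simp: U_def)
  have deg_U: "out_degree G u = k + m" if "u \<in> U" for u
  proof -
    have "{v. u \<rightarrow>\<^bsub>G\<^esub> v} = verts G - {u}"
      using dom_U that by (auto simp: not_dominates_self)
    then show ?thesis
      using that UV cardV by (auto simp: out_degree_eq_card N_def)
  qed
  have e_z: "?e z w = 0" if "w \<in> W" for w
    using that by (auto simp: laplacian_char_entry_def W_def U_def)
  have nadj_z: "\<not> w \<rightarrow>\<^bsub>G\<^esub> z" if "w \<in> W" for w
    using that arcs_ends_symmetric[OF sym_arcs, of w z] by (auto simp: W_def U_def)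

  \<comment> \<open>\<open>T\<close> is \<open>M\<close> after the column operations. Writing them as \<open>M * C = T * E\<close> with triangular
    \<open>C\<close> and \<open>E\<close> of determinants \<open>1\<close> and \<open>x\<close> avoids dividing by \<open>x\<close>.\<close>
  define M where "M = mat N N (\<lambda>(i, j). ?e (xs ! i) (xs ! j))"
  define C where "C = mat N N (\<lambda>(i, j). if i = j \<or> j = k + m then 1 else 0 :: real poly)"
  define E where "E = mat N N (\<lambda>(i, j). if i = j then (if j = k + m then [:0, 1:] else 1)
    else if i = k + m \<and> j < k then 1 else 0 :: real poly)"
  define T where "T = mat N N (\<lambda>(i, j). if j = k + m then 1
    else if j < k then (if i = j then [:- real N, 1:] else 0) else ?e (xs ! i) (xs ! j))"
  define B where "B = mat m m (\<lambda>(i, j). ?e (ws ! i) (ws ! j))"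

  \<comment> \<open>Multiplication by \<open>C\<close> replaces the column of \<open>z\<close> by
    the sum of all columns, whose entries are the row sums x.\<close>
  have MC: "(M * C) $$ (i, j) = (if j = k + m then [:0, 1:] else ?e (xs ! i) (xs ! j))"
    if "i < N" "j < N" for i j
  proof -
    have "(M * C) $$ (i, j) = (\<Sum>l<N. ?e (xs ! i) (xs ! l) * (if l = j \<or> j = k + m then 1 else 0))"
      using that by (simp add: M_def C_def scalar_prod_def lessThan_atLeast0)
    moreover have "(\<Sum>l<N. ?e (xs ! i) (xs ! l)) = (\<Sum>v\<in>verts G. ?e (xs ! i) v)"
      using sum.reindex_bij_betw[OF bij_betw_nth[OF xs(1) _ xs(2)[symmetric]], of "{..<N}" "?e (xs ! i)"]
        xs(3) by simp
    ultimately show ?thesis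
      using that by (auto simp: sum_laplacian_char_entry[OF x_V[OF that(1)]] if_distrib sum.delta
          cong: if_cong)
  qed
  \<comment> \<open>Multiplication by \<open>E\<close> scales the column of ones by x and adds the
    unscaled column to the columns of \<open>U\<close>. There x - N becomes x - (k + m), and 0
    becomes 1.\<close>
  have TE: "(T * E) $$ (i, j) = (if j = k + m then [:0, 1:] else ?e (xs ! i) (xs ! j))"
    if "i < N" "j < N" for i j
  proof -
    have less: "k + m < N"
      by (simp add: N_def)
    have "(T * E) $$ (i, j) = (\<Sum>l<N. T $$ (i, l) * E $$ (l, j))"
      using that by (simp add: T_def E_def scalar_prod_def lessThan_atLeast0)
    \<comment> \<open>Column \<open>j\<close> of \<open>E\<close> has its diagonal entry and, if
      \<open>j < k\<close>, a 1 in row \<open>k + m\<close>; all else is 0.\<close>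
    also have "\<dots> = (\<Sum>l<N. if l = j then T $$ (i, j) * E $$ (j, j) else 0) +
        (\<Sum>l<N. if l = k + m then (if j < k then T $$ (i, k + m) else 0) else 0)"
      unfolding sum.distrib[symmetric] using that by (intro sum.cong) (auto simp: E_def)
    also have "\<dots> = T $$ (i, j) * E $$ (j, j) + (if j < k then T $$ (i, k + m) else 0)"
      using that less by (simp add: sum.delta)
    also have "\<dots> = (if j = k + m then [:0, 1:] else ?e (xs ! i) (xs ! j))"
    proof (cases "j < k")
      case True
      have "?e (xs ! i) (xs ! j) = (if i = j then [:- real (k + m), 1:] else 1)"
        using x_U[OF True] x_V[OF that(1)] x_eq[OF that] dom_U[of "xs ! j" "xs ! i"] deg_U
        by (auto simp: laplacian_char_entry_def)
      then show ?thesis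
        using that less True by (auto simp: T_def E_def N_def one_pCons)
    next
      case False
      then show ?thesis
        using that less by (auto simp: T_def E_def)
    qed
    finally show ?thesis .
  qed
  have carrier: "M \<in> carrier_mat N N" "C \<in> carrier_mat N N"
    "T \<in> carrier_mat N N" "E \<in> carrier_mat N N"
    by (simp_all add: M_def C_def T_def E_def)
  have "M * C = T * E"
  proof (rule eq_matI)
    fix i j
    assume "i < dim_row (T * E)" "j < dim_col (T * E)"
    then have ij: "i < N" "j < N"
      using carrier by auto
    show "(M * C) $$ (i, j) = (T * E) $$ (i, j)"
      unfolding MC[OF ij] TE[OF ij] ..
  qed (use carrier in auto)
  then have "det M * det C = det T * det E"
    by (metis det_mult carrier)
  \<comment> \<open>As \<open>k + m\<close> is the last index, a full last column keeps
    \<open>C\<close> upper triangular and a filled last row keeps \<open>E\<close> lower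
    triangular.\<close>
  moreover have "det C = 1"
    by (subst det_upper_triangular[of _ N])
      (auto simp: C_def upper_triangular_def N_def prod_list_diag_prod)
  moreover have "det E = [:0, 1:]"
    by (subst det_lower_triangular[of N])
      (auto simp: E_def N_def prod_list_diag_prod)
  moreover have "det T = [:- real N, 1:] ^ k * det B"
  proof -
    \<comment> \<open>\<open>T1\<close> belongs to \<open>U\<close>, and \<open>T4\<close> to
      \<open>W\<close> and \<open>z\<close>. The columns of \<open>U\<close> vanish off the
      diagonal, which gives the zero block below \<open>T1\<close>.\<close>
    define T1 where "T1 = mat k k (\<lambda>(i, j). if i = j then [:- real N, 1:] else 0)"
    define T2 where "T2 = mat k (Suc m) (\<lambda>(i, j). T $$ (i, k + j))"
    define T4 where "T4 = four_block_mat B (mat m 1 (\<lambda>_. 1)) (0\<^sub>m 1 m) (1\<^sub>m 1)"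
    have T4: "T4 \<in> carrier_mat (Suc m) (Suc m)"
      using four_block_carrier_mat[of B m m "1\<^sub>m 1" 1 1] by (simp add: T4_def B_def)
    have "T = four_block_mat T1 T2 (0\<^sub>m (Suc m) k) T4"
    proof (rule eq_matI)
      fix i j
      assume "i < dim_row (four_block_mat T1 T2 (0\<^sub>m (Suc m) k) T4)"
        "j < dim_col (four_block_mat T1 T2 (0\<^sub>m (Suc m) k) T4)"
      then have ij: "i < N" "j < N"
        by (auto simp: T1_def T4_def N_def B_def)
      have dims: "dim_row T1 = k" "dim_col T1 = k" "dim_row T4 = Suc m" "dim_col T4 = Suc m"
        using T4 by (simp_all add: T1_def)
      show "T $$ (i, j) = four_block_mat T1 T2 (0\<^sub>m (Suc m) k) T4 $$ (i, j)"
      proof (cases "i < k \<or> j < k")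
        case True
        then show ?thesis
          using ij by (auto simp: index_mat_four_block dims N_def) (auto simp: T_def T1_def T2_def N_def)
      next
        case False
        define i' j' where "i' = i - k" and "j' = j - k"
        have ij': "i = k + i'" "j = k + j'" "i' \<le> m" "j' \<le> m"
          using False ij by (simp_all add: i'_def j'_def N_def)
        have "four_block_mat T1 T2 (0\<^sub>m (Suc m) k) T4 $$ (i, j) = T4 $$ (i', j')"
          using ij ij' by (simp add: index_mat_four_block dims N_def)
        also have "\<dots> = (if j' = m then 1 else if i' = m then 0 else ?e (ws ! i') (ws ! j'))"
          using ij' by (auto simp: T4_def B_def)
        also have "\<dots> = T $$ (i, j)"
        \<comment> \<open>In the row of \<open>z\<close>, the entries in the columns of
          \<open>W\<close> vanish because \<open>z\<close> has no neighbour in \<open>W\<close>;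
          this makes \<open>T4\<close> block triangular.\<close>
        proof (cases "j' < m \<and> i' = m")
          case True
          then have "ws ! j' \<in> W"
            using ws by (auto simp: m_def)
          then show ?thesis
            using True ij ij' x_W[of j'] x_z e_z by (simp add: T_def)
        next
          case False
          then show ?thesis
            using ij ij' x_W[of i'] x_W[of j'] by (auto simp: T_def)
        qed
        finally show ?thesis ..
      qed
    qed (auto simp: T_def T1_def T4_def B_def N_def)
    then have "det T = det T1 * det T4"
      using T4 det_four_block_mat_lower_left_zero[of T1 k T2 "Suc m" "0\<^sub>m (Suc m) k" T4]
      by (simp add: T1_def T2_def)
    also have "det T1 = [:- real N, 1:] ^ k"
      by (subst det_upper_triangular[of _ k])
        (auto simp: T1_def upper_triangular_def prod_list_diag_prod)
    also have "det T4 = det B"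
      using det_four_block_mat_lower_left_zero[of B m "mat m 1 (\<lambda>_. 1)" 1 "0\<^sub>m 1 m" "1\<^sub>m 1"]
      by (simp add: T4_def B_def)
    finally show ?thesis .
  qed
  moreover have "det B = pcompose (laplacian_char_poly (G \<restriction> W)) [:- real k, 1:]"
  proof -
    \<comment> \<open>A vertex of \<open>W\<close> is adjacent to all of \<open>U\<close> but not to
      \<open>z\<close>, so the shift is by \<open>k\<close>.\<close>
    have "{v. w \<rightarrow>\<^bsub>G\<^esub> v \<and> v \<notin> W} = U" if "w \<in> W" for w
      using that UV dom_U(2)[of _ w] nadj_z[of w] by (auto simp: W_def)
    then show ?thesis
      using laplacian_char_poly_induce_pcompose[OF digraph_axioms, of ws k] ws cardU
      by (auto simp: B_def m_def W_def)
  qed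
  moreover have "laplacian_char_poly G = det M"
    using laplacian_char_poly_eq_det[OF digraph_axioms xs(1,2)] xs(3) by (simp add: M_def)
  ultimately show ?thesis
    by (simp add: cardU cardV W_def mult_ac)
qed

section \<open>Comaximality with units and with zero in a commutative ring\<close>

text \<open>The ideal of a unit contains 1 and is therefore the whole ring, which absorbs any other
  ideal.\<close>

lemma comaximal_Units_carrier:
  assumes "cring R" "u \<in> Units R" "y \<in> carrier R"
  shows "Idl\<^bsub>R\<^esub> {u} <+>\<^bsub>R\<^esub> Idl\<^bsub>R\<^esub> {y} = carrier R"
proof -
  interpret cring R by fact
  have u: "u \<in> carrier R"
    using assms(2) by auto
  interpret U: ideal "Idl\<^bsub>R\<^esub> {u}" R
    using u by (simp add: genideal_ideal)
  have Y: "ideal (Idl\<^bsub>R\<^esub> {y}) R"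
    using assms(3) by (simp add: genideal_ideal)
  have "inv\<^bsub>R\<^esub> u \<otimes>\<^bsub>R\<^esub> u \<in> Idl\<^bsub>R\<^esub> {u}"
    using assms(2) u by (intro U.I_l_closed genideal_self') auto
  then have eq: "Idl\<^bsub>R\<^esub> {u} = carrier R"
    using assms(2) U.one_imp_carrier by simp
  have sub: "Idl\<^bsub>R\<^esub> {y} \<subseteq> carrier R"
    using Y by (simp add: ideal.Icarr subsetI)
  \<comment> \<open>The sum of two ideals is treated as the ideal generated by their union.\<close>
  have "Idl\<^bsub>R\<^esub> (carrier R \<union> Idl\<^bsub>R\<^esub> {y}) = carrier R"
    using sub genideal_self[of "carrier R"] genideal_minimal[OF oneideal, of "carrier R"]
    by (simp add: Un_absorb2 subset_antisym)
  then show ?thesis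
    using union_genideal[OF U.is_ideal Y] by (simp add: eq)
qed

text \<open>The zero ideal adds nothing, so the question is whether the principal ideal of
  \<open>y\<close> contains 1.\<close>

lemma comaximal_zero_iff:
  assumes "cring R" "y \<in> carrier R"
  shows "Idl\<^bsub>R\<^esub> {\<zero>\<^bsub>R\<^esub>} <+>\<^bsub>R\<^esub> Idl\<^bsub>R\<^esub> {y} = carrier R \<longleftrightarrow> y \<in> Units R"
proof -
  interpret cring R by fact
  have Y: "ideal (Idl\<^bsub>R\<^esub> {y}) R"
    using assms(2) by (simp add: genideal_ideal)
  interpret Y: ideal "Idl\<^bsub>R\<^esub> {y}" R
    by (rule Y)
  have "Idl\<^bsub>R\<^esub> {\<zero>\<^bsub>R\<^esub>} <+>\<^bsub>R\<^esub> Idl\<^bsub>R\<^esub> {y} = Idl\<^bsub>R\<^esub> {y}"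
    using Y.a_subset by (auto simp: genideal_zero set_add_def' subset_iff)
  also have "Idl\<^bsub>R\<^esub> {y} = PIdl\<^bsub>R\<^esub> y"
    using assms(2) by (simp add: cgenideal_eq_genideal)
  also have "PIdl\<^bsub>R\<^esub> y = carrier R \<longleftrightarrow> y \<in> Units R"
  proof
    assume "PIdl\<^bsub>R\<^esub> y = carrier R"
    then have "\<one>\<^bsub>R\<^esub> \<in> PIdl\<^bsub>R\<^esub> y"
      by simp
    then obtain x where "x \<in> carrier R" "x \<otimes>\<^bsub>R\<^esub> y = \<one>\<^bsub>R\<^esub>"
      by (auto simp: cgenideal_def)
    then show "y \<in> Units R"
      using assms(2) m_comm[of x y] by (auto simp: Units_def)
  next
    assume y: "y \<in> Units R"
    have "inv\<^bsub>R\<^esub> y \<otimes>\<^bsub>R\<^esub> y \<in> Idl\<^bsub>R\<^esub> {y}"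
      using y assms(2) by (intro Y.I_l_closed genideal_self') auto
    then show "PIdl\<^bsub>R\<^esub> y = carrier R"
      using y assms(2) Y.one_imp_carrier by (simp add: cgenideal_eq_genideal)
  qed
  finally show ?thesis .
qed

section \<open>The comaximal graph of the integers modulo n\<close>

theorem theorem3p3:
  fixes n :: nat
  assumes "n > 2"
  defines "\<Gamma> \<equiv> comaximal_graph (residue_ring (int n))"
  defines "G2 \<equiv> \<Gamma> \<restriction> {a \<in> {0..<int n}. a \<noteq> 0 \<and> gcd a (int n) \<noteq> 1}"
  shows "laplacian_char_poly \<Gamma> =
    [:0, 1:] * [:- real n, 1:] ^ totient n *
      pcompose (laplacian_char_poly G2) [:- real (totient n), 1:]"
proof -
  let ?R = "residue_ring (int n)"
  define U where "U = {u. 0 < u \<and> u < int n \<and> coprime u (int n)}"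
  interpret residues "int n" ?R
    using assms(1) by unfold_locales simp_all
  have graph: "graph \<Gamma>"
    using assms(1) by (simp add: \<Gamma>_def graph_comaximal_graph_residue_ring)
  have units: "Units ?R = U"
    by (simp add: U_def res_units_eq)
  have verts: "verts \<Gamma> = {0..<int n}"
    by (auto simp: \<Gamma>_def comaximal_graph_def res_carrier_eq)
  have adj: "x \<rightarrow>\<^bsub>\<Gamma>\<^esub> y \<longleftrightarrow> x \<in> carrier ?R \<and> y \<in> carrier ?R \<and> x \<noteq> y \<and>
      Idl\<^bsub>?R\<^esub> {x} <+>\<^bsub>?R\<^esub> Idl\<^bsub>?R\<^esub> {y} = carrier ?R" for x y
    by (auto simp: \<Gamma>_def comaximal_graph_def arcs_ends_conv)
  have U_eq: "{u. 0 \<rightarrow>\<^bsub>\<Gamma>\<^esub> u} = U"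
    using comaximal_zero_iff[OF cring] units
    by (auto simp: adj res_zero_eq) (auto simp: U_def res_carrier_eq)
  \<comment> \<open>\<open>totatives n\<close> allows the value \<open>n\<close>, whereas
    \<open>U\<close> stops below it. They agree because \<open>n > 1\<close> is not coprime to
    itself.\<close>
  have "bij_betw int (totatives n) U"
    using assms(1)
    by (intro bij_betwI[of _ _ _ nat])
      (auto simp: U_def totatives_def coprime_int_iff le_less nat_less_iff
        simp flip: coprime_int_iff)
  then have "card U = totient n"
    using bij_betw_same_card[of int "totatives n" U] by (simp add: totient_def)
  moreover have "verts \<Gamma> - insert 0 U = {a \<in> {0..<int n}. a \<noteq> 0 \<and> gcd a (int n) \<noteq> 1}"
    by (auto simp: verts U_def coprime_iff_gcd_eq_1)
  moreover have "u \<rightarrow>\<^bsub>\<Gamma>\<^esub> v" if "0 \<rightarrow>\<^bsub>\<Gamma>\<^esub> u" "v \<in> verts \<Gamma>" "v \<noteq> u" for u v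
    using that comaximal_Units_carrier[OF cring, of u v] U_eq units
    by (auto simp: adj verts res_carrier_eq)
  ultimately show ?thesis
    using laplacian_char_poly_dominating_neighbours[OF graph, of 0] assms(1)
    by (simp add: U_eq verts G2_def)
qed

end
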